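(* Let $s \in (0,1)$ and let $f,g:\mathbb{R}^d\to(0,\infty)$ be two (strictly positive) probability densities on $\mathbb{R}^d$ satisfying $i_{s}(f)<\infty$ and $i_{s}(g)< \infty$. Then for every $\alpha\in(0,1)$, $$i_{s}\big(f_{\sqrt{\alpha}} \ast g_{\sqrt{1-\alpha}}\big) \leq \alpha^{s}\, i_{s}(f) + (1-\alpha)^{s}\, i_{s}(g).$$
   Context: Probability densities are with respect to Lebesgue measure, $\ast$ denotes convolution on $\mathbb{R}^d$, and for $c>0$ the rescaled density is $f_{c}(x)=c^{-d}f(x/c)$, $x\in\mathbb{R}^d$. For $s\in(0,1)$, the fractional Fisher information of a strictly positive measurable function $f$ on $\mathbb{R}^d$ is $$i_{s}(f) = c(d,s) \int_{\mathbb{R}^{d}} \int_{\mathbb{R}^{d}} \frac{f(x)\, \Upsilon\big(\log f(x+h) - \log f(x)\big)}{|h|^{d+2s}} \, \mathrm{d}h\, \mathrm{d}x\in[0,\infty],$$ where $\Upsilon(r)=e^r-1-r$ for $r\in\mathbb{R}$ and $$c(d,s)= \left(\int_{\mathbb{R}^{d}} \frac{1-\cos(\xi_{1})}{|\xi|^{d+2s}} \, \mathrm{d}\xi\right)^{-1}.$$ The value $i_s(f)$ does not depend on the values of $f$ on Lebesgue null sets; in particular, the convolution above, which is finite and strictly positive almost everywhere, may be modified on a null set so as to take values in $(0,\infty)$. *)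

theory Defs
  imports "HOL-Analysis.Analysis"
begin

text \<open>
  The space $R^d$ is an arbitrary type of class \<^class>\<open>euclidean_space\<close>, with \<open>d = DIM('a)\<close>.
  Measurability and integrals refer to the completed measure \<^term>\<open>lebesgue\<close>, so
  densities need only be Lebesgue measurable.
\<close>

definition strictly_positive_density :: "('a::euclidean_space \<Rightarrow> real) \<Rightarrow> bool" where
  "strictly_positive_density f \<longleftrightarrow>
     f \<in> borel_measurable lebesgue \<and> (\<forall>x. 0 < f x) \<and> (\<integral>\<^sup>+x. ennreal (f x) \<partial>lebesgue) = 1"

definition rescale :: "real \<Rightarrow> ('a::euclidean_space \<Rightarrow> real) \<Rightarrow> 'a \<Rightarrow> real" where
  "rescale c f x = f (x /\<^sub>R c) / c ^ DIM('a)"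

text \<open>
  The convolution of two strictly positive densities lies strictly between 0 and infinity
  almost everywhere. On the exceptional null set we assign the arbitrary value 1, so that
  the result is real valued and strictly positive everywhere.
\<close>

definition convolution ::
  "('a::euclidean_space \<Rightarrow> real) \<Rightarrow> ('a \<Rightarrow> real) \<Rightarrow> 'a \<Rightarrow> real" where
  "convolution f g x =
     (let v = \<integral>\<^sup>+y. ennreal (f (x - y) * g y) \<partial>lebesgue
      in if 0 < v \<and> v < \<infinity> then enn2real v else 1)"

definition Upsilon :: "real \<Rightarrow> real" where
  "Upsilon r = exp r - 1 - r"

text \<open>
  The constant $c(d,s)$. The first coordinate of \<open>\<xi>\<close> is its inner product with a chosen vector of
  \<^term>\<open>Basis\<close>; by rotation invariance the choice does not affect the value. The argument
  of type \<^typ>\<open>'a itself\<close> carries the dimension.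
\<close>

definition fisher_const :: "'a::euclidean_space itself \<Rightarrow> real \<Rightarrow> ennreal" where
  "fisher_const _ s =
     inverse (\<integral>\<^sup>+\<xi>. ennreal ((1 - cos (\<xi> \<bullet> (SOME b::'a. b \<in> Basis)))
                            / norm \<xi> powr (real DIM('a) + 2 * s)) \<partial>lebesgue)"

text \<open>
  Since \<^const>\<open>Upsilon\<close> is nonnegative, for positive \<open>f\<close> the integrand is nonnegative and the
  truncation in \<^const>\<open>ennreal\<close> has no effect.
\<close>

definition frac_fisher :: "real \<Rightarrow> ('a::euclidean_space \<Rightarrow> real) \<Rightarrow> ennreal" where
  "frac_fisher s f =
     fisher_const TYPE('a) s *
     (\<integral>\<^sup>+x. \<integral>\<^sup>+h. ennreal (f x * Upsilon (ln (f (x + h)) - ln (f x))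
                        / norm h powr (real DIM('a) + 2 * s)) \<partial>lebesgue \<partial>lebesgue)"

end

theory Submission
  imports Defs
begin

text \<open>
  For positive \<open>a\<close> and \<open>b\<close> put \<open>\<phi>(a, b) = a \<Upsilon>(ln b - ln a) = b - a - a (ln b - ln a)\<close>, the integrand of
  the relative entropy. Interchanging the order of integration,
  \<open>i\<^sub>s(f) = c(d, s) \<integral> D\<^sub>h(f) / |h|^(d + 2s) dh\<close>, where \<open>D\<^sub>h(f) = \<integral> \<phi>(f(x), f(x + h)) dx\<close> is the relative
  entropy of \<open>f\<close> with respect to its translate by \<open>h\<close>. So the fractional Fisher information is
  a mixture of relative entropies, and the inequality follows from an inequality for each fixed \<open>h\<close>,
  which is a fractional counterpart of the Blachman-Stam argument.

  Write \<open>F\<close> and \<open>G\<close> for the rescaled densities. A translation of \<open>F * G\<close> by \<open>h\<close> may be distributed over the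
  two factors in any proportion: shift \<open>F\<close> by \<open>\<alpha> h\<close> and \<open>G\<close> by \<open>(1 - \<alpha>) h\<close>. Convolution is the image of
  the product measure under addition, hence does not increase relative entropy, and relative
  entropy is additive over products. This gives
  \<open>D\<^sub>h(F * G) \<le> D\<^bsub>\<alpha>h\<^esub>(F) + D\<^bsub>(1-\<alpha>)h\<^esub>(G)\<close> (lemma \<open>transl_div_convolution_le\<close>, from
  \<open>kl_div_convolution_le\<close> and \<open>kl_div_product\<close>). Relative entropy is invariant under dilations, so
  the right-hand side equals \<open>D\<^sub>k(f) + D\<^sub>l(g)\<close> with \<open>k = \<surd>\<alpha> h\<close> and \<open>l = \<surd>(1 - \<alpha>) h\<close> (lemma
  \<open>transl_div_rescale\<close>). Substituting \<open>k\<close>, respectively \<open>l\<close>, for \<open>h\<close> in the integral against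
  \<open>|h|^(-d - 2s)\<close> produces the factors \<open>\<alpha>^s\<close> and \<open>(1 - \<alpha>)^s\<close> (lemma \<open>transl_div_dilate_integral\<close>).

  The interchanges of integrals require joint measurability of expressions like \<open>f(x + h)\<close>, which is
  immediate for Borel functions. The two densities are therefore first replaced by Borel functions
  equal to them almost everywhere; both sides of the inequality are unaffected by this.
\<close>

section \<open>Affine substitutions in Lebesgue integrals\<close>

lemma nn_integral_lborel_affine:
  fixes t :: "'a::euclidean_space" and c :: real
  assumes [measurable]: "f \<in> borel_measurable borel" and c: "c \<noteq> 0"
  shows "(\<integral>\<^sup>+x. f x \<partial>lborel) = ennreal (\<bar>c\<bar> ^ DIM('a)) * (\<integral>\<^sup>+x. f (t + c *\<^sub>R x) \<partial>lborel)"
proof -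
  have "(\<integral>\<^sup>+x. f x \<partial>lborel) = (\<integral>\<^sup>+x. f x \<partial>density (distr lborel borel (\<lambda>x. t + c *\<^sub>R x)) (\<lambda>_. \<bar>c\<bar>^DIM('a)))"
    using lborel_affine[OF c, of t] by simp
  also have "\<dots> = ennreal (\<bar>c\<bar> ^ DIM('a)) * (\<integral>\<^sup>+x. f (t + c *\<^sub>R x) \<partial>lborel)"
    by (simp add: nn_integral_density nn_integral_distr nn_integral_cmult)
  finally show ?thesis .
qed

lemma nn_integral_lborel_translate:
  fixes t :: "'a::euclidean_space"
  assumes "f \<in> borel_measurable borel"
  shows "(\<integral>\<^sup>+x. f (x + t) \<partial>lborel) = (\<integral>\<^sup>+x. f x \<partial>lborel)"
  using nn_integral_lborel_affine[OF assms, of 1 t] by (simp add: add.commute)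

lemma AE_lborel_affine:
  fixes t :: "'a::euclidean_space" and c :: real
  assumes "AE x in lborel. P x" and c: "c \<noteq> 0"
  shows "AE x in lborel. P (t + c *\<^sub>R x)"
proof -
  from assms(1) obtain N where N: "N \<in> null_sets lborel" "{x. \<not> P x} \<subseteq> N"
    by (auto simp: eventually_ae_filter)
  then have [measurable]: "N \<in> sets borel" by (auto simp: null_sets_def)
  have "(\<integral>\<^sup>+x. indicator N x \<partial>lborel) = (0::ennreal)"
    using N by (simp add: null_setsD1)
  then have "(\<integral>\<^sup>+x. indicator N (t + c *\<^sub>R x) \<partial>lborel) = (0::ennreal)"
    using nn_integral_lborel_affine[of "indicator N" c t] c by simp
  then have "AE x in lborel. indicator N (t + c *\<^sub>R x) = (0::ennreal)"
    by (subst (asm) nn_integral_0_iff_AE) auto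
  then show ?thesis
    by eventually_elim (use N(2) in \<open>auto simp: indicator_def split: if_splits\<close>)
qed

section \<open>The relative entropy integrand\<close>

definition rel_ent :: "real \<Rightarrow> real \<Rightarrow> real" where
  "rel_ent a b = a * Upsilon (ln b - ln a)"

lemma rel_ent_measurable [measurable]:
  assumes [measurable]: "u \<in> borel_measurable M" "w \<in> borel_measurable M"
  shows "(\<lambda>x. rel_ent (u x) (w x)) \<in> borel_measurable M"
  unfolding rel_ent_def Upsilon_def by measurable

lemma rel_ent_eq: "0 < a \<Longrightarrow> 0 < b \<Longrightarrow> rel_ent a b = b - a - a * (ln b - ln a)"
  by (simp add: rel_ent_def Upsilon_def exp_diff field_simps)

lemma rel_ent_nonneg: "0 < a \<Longrightarrow> 0 \<le> rel_ent a b"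
  unfolding rel_ent_def Upsilon_def using exp_ge_add_one_self[of "ln b - ln a"]
  by (intro mult_nonneg_nonneg) linarith+

text \<open>
  The function \<^const>\<open>rel_ent\<close> is convex and positively homogeneous of degree one, so its graph lies
  above its tangent plane at \<open>(A, B)\<close>, and that plane passes through the origin: there is no constant
  term. This is \<open>ln t \<le> t - 1\<close> at the quotient \<open>t\<close> of \<open>A / B\<close> and \<open>a / b\<close>.
\<close>

lemma rel_ent_tangent:
  assumes "0 < a" "0 < b" "0 < A" "0 < B"
  shows "(1 - A / B) * b - (ln B - ln A) * a \<le> rel_ent a b"
proof -
  have "ln (A * b / (B * a)) \<le> A * b / (B * a) - 1"
    using assms by (intro ln_le_minus_one) auto
  then have "a * ln (A * b / (B * a)) \<le> a * (A * b / (B * a) - 1)"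
    using assms by (intro mult_left_mono) auto
  also have "a * (A * b / (B * a) - 1) = A / B * b - a"
    using assms by (simp add: field_simps)
  finally show ?thesis
    using assms by (simp add: rel_ent_eq ln_div ln_mult algebra_simps)
qed

text \<open>
  Jensen's inequality for a homogeneous convex function, valid over a measure of any total mass:
  integrate the tangent plane at the point \<open>(A, B)\<close> of the integrals. Being linear, it integrates to
  its own value at \<open>(A, B)\<close>, which is \<open>rel_ent A B\<close>.
\<close>

lemma rel_ent_nn_integral_le:
  assumes [measurable]: "u \<in> borel_measurable M" "w \<in> borel_measurable M"
    and pos: "\<And>x. 0 < u x" "\<And>x. 0 < w x"
    and u: "(\<integral>\<^sup>+x. ennreal (u x) \<partial>M) = ennreal A" and w: "(\<integral>\<^sup>+x. ennreal (w x) \<partial>M) = ennreal B"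
    and "0 < A" "0 < B"
  shows "ennreal (rel_ent A B) \<le> (\<integral>\<^sup>+x. ennreal (rel_ent (u x) (w x)) \<partial>M)"
proof (cases "(\<integral>\<^sup>+x. ennreal (rel_ent (u x) (w x)) \<partial>M) = \<infinity>")
  case False
  have iu: "integrable M u" "integral\<^sup>L M u = A"
    using u pos \<open>0 < A\<close> by (auto intro!: integrableI_nonneg simp: integral_eq_nn_integral less_imp_le)
  have iw: "integrable M w" "integral\<^sup>L M w = B"
    using w pos \<open>0 < B\<close> by (auto intro!: integrableI_nonneg simp: integral_eq_nn_integral less_imp_le)
  have ie: "integrable M (\<lambda>x. rel_ent (u x) (w x))"
    using False pos by (intro integrableI_nonneg) (auto simp: rel_ent_nonneg less_top)
  have "rel_ent A B = (1 - A / B) * B - (ln B - ln A) * A"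
    using \<open>0 < A\<close> \<open>0 < B\<close> by (simp add: rel_ent_eq field_simps)
  also have "\<dots> = (\<integral>x. (1 - A / B) * w x - (ln B - ln A) * u x \<partial>M)"
    using iu iw by simp
  also have "\<dots> \<le> (\<integral>x. rel_ent (u x) (w x) \<partial>M)"
    using iu iw ie pos \<open>0 < A\<close> \<open>0 < B\<close> by (intro integral_mono) (auto intro: rel_ent_tangent)
  finally show ?thesis
    using ie pos by (simp add: nn_integral_eq_integral rel_ent_nonneg ennreal_leI)
qed simp

section \<open>Relative entropy of product densities and of convolutions\<close>

text \<open>
  The Borel counterpart of \<^const>\<open>strictly_positive_density\<close>: unlike Lebesgue measurability, Borel
  measurability is stable under composition with the maps \<open>(x, h) \<mapsto> x + h\<close> on the product
  \<open>\<sigma>\<close>-algebra, as Fubini's theorem requires.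
\<close>

definition pos_density :: "('a::euclidean_space \<Rightarrow> real) \<Rightarrow> bool" where
  "pos_density f \<longleftrightarrow>
     f \<in> borel_measurable borel \<and> (\<forall>x. 0 < f x) \<and> (\<integral>\<^sup>+x. ennreal (f x) \<partial>lborel) = 1"

lemma pos_densityD:
  assumes "pos_density f"
  shows "f \<in> borel_measurable borel" "\<And>x. 0 < f x" "(\<integral>\<^sup>+x. ennreal (f x) \<partial>lborel) = 1"
  using assms by (auto simp: pos_density_def)

definition kl_div :: "('a::euclidean_space \<Rightarrow> real) \<Rightarrow> ('a \<Rightarrow> real) \<Rightarrow> ennreal" where
  "kl_div f g = (\<integral>\<^sup>+x. ennreal (rel_ent (f x) (g x)) \<partial>lborel)"

lemma pos_density_translate:
  assumes "pos_density f"
  shows "pos_density (\<lambda>x. f (x + t))"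
proof -
  note [measurable] = pos_densityD(1)[OF assms]
  show ?thesis
    using nn_integral_lborel_translate[of "\<lambda>x. ennreal (f x)" t] pos_densityD[OF assms]
    by (auto simp: pos_density_def)
qed

lemma pos_density_rescale:
  fixes f :: "'a::euclidean_space \<Rightarrow> real"
  assumes "pos_density f" and c: "0 < c"
  shows "pos_density (rescale c f)"
proof -
  note [measurable] = pos_densityD(1)[OF assms(1)]
  have m: "rescale c f \<in> borel_measurable borel" unfolding rescale_def by measurable
  then have "(\<integral>\<^sup>+x. ennreal (rescale c f x) \<partial>lborel)
      = ennreal (c ^ DIM('a)) * (\<integral>\<^sup>+x. ennreal (rescale c f (0 + c *\<^sub>R x)) \<partial>lborel)"
    using c by (subst nn_integral_lborel_affine[where c=c and t=0]) auto
  also have "\<dots> = (\<integral>\<^sup>+x. ennreal (c ^ DIM('a)) * ennreal (rescale c f (c *\<^sub>R x)) \<partial>lborel)"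
    using m by (subst nn_integral_cmult) auto
  also have "\<dots> = (\<integral>\<^sup>+x. ennreal (f x) \<partial>lborel)"
    using c pos_densityD(2)[OF assms(1)]
    by (intro nn_integral_cong) (simp add: rescale_def ennreal_mult''[symmetric] less_imp_le)
  finally show ?thesis
    using m c pos_densityD[OF assms(1)] by (auto simp: pos_density_def rescale_def)
qed

text \<open>
  Additivity of relative entropy. The logarithms of the products split, and the remaining terms
  differ pointwise by
  \<open>rel_ent (u v) (u' v') - v rel_ent u u' - u rel_ent v v' = (u' - u) (v' - v)\<close>,
  which integrates to zero over \<open>y\<close> because \<open>G\<close> and \<open>G'\<close> have the same mass.
\<close>

lemma kl_div_product:
  fixes F F' G G' :: "'a::euclidean_space \<Rightarrow> real"
  assumes F: "pos_density F" and F': "pos_density F'" and G: "pos_density G" and G': "pos_density G'"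
  shows "(\<integral>\<^sup>+x. \<integral>\<^sup>+y. ennreal (rel_ent (F x * G y) (F' x * G' y)) \<partial>lborel \<partial>lborel)
    = kl_div F F' + kl_div G G'"
proof -
  note [measurable] = pos_densityD(1)[OF F] pos_densityD(1)[OF F'] pos_densityD(1)[OF G] pos_densityD(1)[OF G']
  note pos = pos_densityD(2)[OF F] pos_densityD(2)[OF F'] pos_densityD(2)[OF G] pos_densityD(2)[OF G']
  have inner: "(\<integral>\<^sup>+y. ennreal (rel_ent (F x * G y) (F' x * G' y)) \<partial>lborel)
      = ennreal (rel_ent (F x) (F' x)) + ennreal (F x) * kl_div G G'" for x
  proof -
    \<comment> \<open>The product \<open>(u' - u) (v' - v)\<close> has no sign; its negative terms are moved to the left so that
      everything is an identity between nonnegative extended reals.\<close>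
    have pointwise: "ennreal (rel_ent (F x * G y) (F' x * G' y)) + ennreal (F' x) * ennreal (G y) + ennreal (F x) * ennreal (G' y)
       = ennreal (rel_ent (F x) (F' x)) * ennreal (G y) + ennreal (F x) * ennreal (rel_ent (G y) (G' y))
         + ennreal (F' x) * ennreal (G' y) + ennreal (F x) * ennreal (G y)" (is "?L = ?R") for y
    proof -
      note p = pos(1)[of x] pos(2)[of x] pos(3)[of y] pos(4)[of y]
      have "rel_ent (F x * G y) (F' x * G' y) + F' x * G y + F x * G' y
        = rel_ent (F x) (F' x) * G y + F x * rel_ent (G y) (G' y) + F' x * G' y + F x * G y"
        using p by (simp add: rel_ent_eq ln_mult algebra_simps)
      moreover have "?L = ennreal (rel_ent (F x * G y) (F' x * G' y) + F' x * G y + F x * G' y)"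
        using p by (simp add: rel_ent_nonneg ennreal_mult less_imp_le)
      moreover have "?R = ennreal (rel_ent (F x) (F' x) * G y + F x * rel_ent (G y) (G' y) + F' x * G' y + F x * G y)"
        using p by (simp add: rel_ent_nonneg ennreal_mult less_imp_le)
      ultimately show ?thesis by simp
    qed
    have "(\<integral>\<^sup>+y. ennreal (rel_ent (F x * G y) (F' x * G' y)) \<partial>lborel) + ennreal (F' x) + ennreal (F x)
      = (\<integral>\<^sup>+y. ennreal (rel_ent (F x * G y) (F' x * G' y)) + ennreal (F' x) * ennreal (G y) + ennreal (F x) * ennreal (G' y) \<partial>lborel)"
      using pos_densityD(3)[OF G] pos_densityD(3)[OF G'] by (simp add: nn_integral_add nn_integral_cmult)
    also have "\<dots> = ennreal (rel_ent (F x) (F' x)) + ennreal (F x) * kl_div G G' + ennreal (F' x) + ennreal (F x)"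
      unfolding pointwise kl_div_def
      using pos_densityD(3)[OF G] pos_densityD(3)[OF G'] by (simp add: nn_integral_add nn_integral_cmult)
    finally show ?thesis
      by (simp add: ennreal_add_left_cancel add.commute[of _ "ennreal _"] add.assoc)
  qed
  show ?thesis
    unfolding inner using pos_densityD(3)[OF F]
    by (simp add: nn_integral_add nn_integral_multc kl_div_def)
qed

lemma convolution_pos: "0 < convolution F G x"
  by (simp add: convolution_def Let_def enn2real_positive_iff)

text \<open>
  The default value of \<^const>\<open>convolution\<close> is taken on a null set only: the integral is never zero as
  the integrand is positive, and it is finite almost everywhere as its integral over \<open>x\<close> is 1.
\<close>

lemma convolution_nn_integral_AE:
  fixes F G :: "'a::euclidean_space \<Rightarrow> real"
  assumes F: "pos_density F" and G: "pos_density G"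
  shows "AE x in lborel. (\<integral>\<^sup>+y. ennreal (F (x - y) * G y) \<partial>lborel) = ennreal (convolution F G x)"
proof -
  note [measurable] = pos_densityD(1)[OF F] pos_densityD(1)[OF G]
  note pos = pos_densityD(2)[OF F] pos_densityD(2)[OF G]
  define V where "V x = (\<integral>\<^sup>+y. ennreal (F (x - y) * G y) \<partial>lborel)" for x
  have [measurable]: "V \<in> borel_measurable borel" unfolding V_def by measurable
  have V_pos: "0 < V x" for x
  proof (rule ccontr)
    assume "\<not> 0 < V x"
    then have "V x = 0" by (simp add: not_less)
    then have "AE y in lborel. ennreal (F (x - y) * G y) = 0"
      unfolding V_def by (subst (asm) nn_integral_0_iff_AE) auto
    moreover have "ennreal (F (x - y) * G y) \<noteq> 0" for y
      using mult_pos_pos[OF pos(1)[of "x - y"] pos(2)[of y]] by (simp add: ennreal_eq_0_iff not_le)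
    ultimately have "AE y in (lborel :: 'a measure). False" by simp
    then show False by (simp add: eventually_False ae_filter_eq_bot_iff)
  qed
  have "(\<integral>\<^sup>+x. V x \<partial>lborel) = (\<integral>\<^sup>+y. \<integral>\<^sup>+x. ennreal (F (x - y) * G y) \<partial>lborel \<partial>lborel)"
    unfolding V_def by (rule lborel_pair.Fubini') measurable
  also have "\<dots> = (\<integral>\<^sup>+y. ennreal (G y) \<partial>lborel)"
    using nn_integral_lborel_translate[of "\<lambda>x. ennreal (F x)"] pos_densityD(3)[OF F] pos
    by (simp add: ennreal_mult less_imp_le nn_integral_multc
          diff_conv_add_uminus del: add_uminus_conv_diff)
  finally have "(\<integral>\<^sup>+x. V x \<partial>lborel) \<noteq> \<infinity>"
    using pos_densityD(3)[OF G] by simp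
  then have "AE x in lborel. V x \<noteq> \<infinity>"
    by (intro nn_integral_noteq_infinite) auto
  then show ?thesis
  proof eventually_elim
    case (elim x)
    then have "convolution F G x = enn2real (V x)"
      using V_pos[of x] by (simp add: convolution_def V_def[symmetric] nn_integral_completion less_top)
    then show ?case
      using elim V_pos[of x] by (simp add: V_def[symmetric] enn2real_positive_iff less_top)
  qed
qed

lemma convolution_measurable:
  assumes [measurable]: "F \<in> borel_measurable borel" "G \<in> borel_measurable borel"
  shows "convolution F G \<in> borel_measurable borel"
  unfolding convolution_def[abs_def] nn_integral_completion Let_def by measurable

text \<open>
  The data processing inequality for the addition map. For almost every \<open>x\<close>, Jensen's inequality
  bounds the entropy integrand of the two convolutions at \<open>x\<close> by an integral over the fibre
  \<open>{(x - y, y)}\<close>; integrated over \<open>x\<close>, these bounds add up to the relative entropy of the products.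
\<close>

lemma kl_div_convolution_le:
  fixes F F' G G' :: "'a::euclidean_space \<Rightarrow> real"
  assumes F: "pos_density F" and F': "pos_density F'" and G: "pos_density G" and G': "pos_density G'"
  shows "kl_div (convolution F G) (convolution F' G') \<le> kl_div F F' + kl_div G G'"
proof -
  note [measurable] = pos_densityD(1)[OF F] pos_densityD(1)[OF F'] pos_densityD(1)[OF G] pos_densityD(1)[OF G']
  note pos = pos_densityD(2)[OF F] pos_densityD(2)[OF F'] pos_densityD(2)[OF G] pos_densityD(2)[OF G']
  have "kl_div (convolution F G) (convolution F' G')
      \<le> (\<integral>\<^sup>+x. \<integral>\<^sup>+y. ennreal (rel_ent (F (x - y) * G y) (F' (x - y) * G' y)) \<partial>lborel \<partial>lborel)"
    unfolding kl_div_def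
  proof (rule nn_integral_mono_AE)
    show "AE x in lborel. ennreal (rel_ent (convolution F G x) (convolution F' G' x))
      \<le> (\<integral>\<^sup>+y. ennreal (rel_ent (F (x - y) * G y) (F' (x - y) * G' y)) \<partial>lborel)"
      using convolution_nn_integral_AE[OF F G] convolution_nn_integral_AE[OF F' G']
      by eventually_elim (use pos in \<open>auto intro!: rel_ent_nn_integral_le convolution_pos\<close>)
  qed
  also have "\<dots> = (\<integral>\<^sup>+y. \<integral>\<^sup>+x. ennreal (rel_ent (F (x - y) * G y) (F' (x - y) * G' y)) \<partial>lborel \<partial>lborel)"
    by (rule lborel_pair.Fubini') measurable
  also have "\<dots> = (\<integral>\<^sup>+y. \<integral>\<^sup>+x. ennreal (rel_ent (F x * G y) (F' x * G' y)) \<partial>lborel \<partial>lborel)"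
  proof (rule nn_integral_cong)
    fix y :: 'a
    show "(\<integral>\<^sup>+x. ennreal (rel_ent (F (x - y) * G y) (F' (x - y) * G' y)) \<partial>lborel)
      = (\<integral>\<^sup>+x. ennreal (rel_ent (F x * G y) (F' x * G' y)) \<partial>lborel)"
      using nn_integral_lborel_translate[of "\<lambda>x. ennreal (rel_ent (F x * G y) (F' x * G' y))" "- y"]
      by simp
  qed
  also have "\<dots> = (\<integral>\<^sup>+x. \<integral>\<^sup>+y. ennreal (rel_ent (F x * G y) (F' x * G' y)) \<partial>lborel \<partial>lborel)"
    by (rule lborel_pair.Fubini') measurable
  also have "\<dots> = kl_div F F' + kl_div G G'"
    by (rule kl_div_product[OF F F' G G'])
  finally show ?thesis .
qed

section \<open>The entropy cost of a translation\<close>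

definition transl_div :: "('a::euclidean_space \<Rightarrow> real) \<Rightarrow> 'a \<Rightarrow> ennreal" where
  "transl_div f h = kl_div f (\<lambda>x. f (x + h))"

lemma transl_div_measurable [measurable]:
  assumes [measurable]: "f \<in> borel_measurable borel"
  shows "transl_div f \<in> borel_measurable borel"
  unfolding transl_div_def[abs_def] kl_div_def by measurable

lemma convolution_translate:
  fixes F G :: "'a::euclidean_space \<Rightarrow> real"
  assumes [measurable]: "F \<in> borel_measurable borel" "G \<in> borel_measurable borel"
  shows "convolution F G (x + (h + k)) = convolution (\<lambda>x. F (x + h)) (\<lambda>x. G (x + k)) x"
proof -
  have "(\<integral>\<^sup>+y. ennreal (F (x + (h + k) - y) * G y) \<partial>lborel)
      = (\<integral>\<^sup>+y. ennreal (F (x - y + h) * G (y + k)) \<partial>lborel)"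
    using nn_integral_lborel_translate[of "\<lambda>y. ennreal (F (x + (h + k) - y) * G y)" k, symmetric]
    by (simp add: algebra_simps)
  then show ?thesis
    by (simp add: convolution_def nn_integral_completion)
qed

lemma transl_div_convolution_le:
  assumes F: "pos_density F" and G: "pos_density G"
  shows "transl_div (convolution F G) (h + k) \<le> transl_div F h + transl_div G k"
  using kl_div_convolution_le[OF F pos_density_translate[OF F, of h] G pos_density_translate[OF G, of k]]
    convolution_translate[OF pos_densityD(1)[OF F] pos_densityD(1)[OF G]]
  by (simp add: transl_div_def)

text \<open>
  Relative entropy is invariant under the bijection \<open>x \<mapsto> c x\<close>, which turns a translation by \<open>h / c\<close> into
  one by \<open>h\<close>.
\<close>

lemma transl_div_rescale:
  fixes f :: "'a::euclidean_space \<Rightarrow> real"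
  assumes f: "pos_density f" and c: "0 < c"
  shows "transl_div (rescale c f) h = transl_div f (h /\<^sub>R c)"
proof -
  note [measurable] = pos_densityD(1)[OF f] pos_densityD(1)[OF pos_density_rescale[OF f c]]
  have rel_ent_scale: "rel_ent (a / m) (b / m) = rel_ent a b / m" if "0 < a" "0 < b" "0 < m" for a b m
    using that by (simp add: rel_ent_def ln_div)
  have "transl_div (rescale c f) h = ennreal (c ^ DIM('a)) *
      (\<integral>\<^sup>+x. ennreal (rel_ent (rescale c f (0 + c *\<^sub>R x)) (rescale c f (0 + c *\<^sub>R x + h))) \<partial>lborel)"
    unfolding transl_div_def kl_div_def using c
    by (subst nn_integral_lborel_affine[where c=c and t=0]) auto
  also have "\<dots> = (\<integral>\<^sup>+x. ennreal (c ^ DIM('a)) *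
      ennreal (rel_ent (rescale c f (c *\<^sub>R x)) (rescale c f (c *\<^sub>R x + h))) \<partial>lborel)"
    by (subst nn_integral_cmult) auto
  also have "\<dots> = transl_div f (h /\<^sub>R c)"
    unfolding transl_div_def kl_div_def
    using c pos_densityD(2)[OF f]
    by (intro nn_integral_cong)
      (simp add: rescale_def rel_ent_scale ennreal_mult''[symmetric] rel_ent_nonneg scaleR_add_right)
  finally show ?thesis .
qed

section \<open>The fractional Fisher information as an integral over translations\<close>

lemma frac_fisher_eq_transl_div:
  fixes f :: "'a::euclidean_space \<Rightarrow> real"
  assumes [measurable]: "f \<in> borel_measurable borel" and pos: "\<And>x. 0 < f x"
  shows "frac_fisher s f = fisher_const TYPE('a) s *
    (\<integral>\<^sup>+h. transl_div f h * ennreal (1 / norm h powr (real DIM('a) + 2 * s)) \<partial>lborel)"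
proof -
  have "(\<integral>\<^sup>+x. \<integral>\<^sup>+h. ennreal (f x * Upsilon (ln (f (x + h)) - ln (f x))
      / norm h powr (real DIM('a) + 2 * s)) \<partial>lborel \<partial>lborel)
    = (\<integral>\<^sup>+h. \<integral>\<^sup>+x. ennreal (rel_ent (f x) (f (x + h)) / norm h powr (real DIM('a) + 2 * s)) \<partial>lborel \<partial>lborel)"
    unfolding rel_ent_def[symmetric] by (rule lborel_pair.Fubini'[symmetric]) measurable
  also have "\<dots> = (\<integral>\<^sup>+h. transl_div f h * ennreal (1 / norm h powr (real DIM('a) + 2 * s)) \<partial>lborel)"
  proof (rule nn_integral_cong)
    fix h :: 'a
    have "ennreal (rel_ent (f x) (f (x + h)) / norm h powr (real DIM('a) + 2 * s))
      = ennreal (rel_ent (f x) (f (x + h))) * ennreal (1 / norm h powr (real DIM('a) + 2 * s))" for x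
      using pos by (simp add: ennreal_mult[symmetric] rel_ent_nonneg)
    then show "(\<integral>\<^sup>+x. ennreal (rel_ent (f x) (f (x + h)) / norm h powr (real DIM('a) + 2 * s)) \<partial>lborel)
      = transl_div f h * ennreal (1 / norm h powr (real DIM('a) + 2 * s))"
      by (simp add: transl_div_def kl_div_def nn_integral_multc)
  qed
  finally show ?thesis
    by (simp add: frac_fisher_def nn_integral_completion)
qed

text \<open>
  In the new variable \<open>k = c h\<close> the weight contributes \<open>c^(d + 2s)\<close> and the volume element \<open>c^(-d)\<close>.
\<close>

lemma transl_div_dilate_integral:
  fixes f :: "'a::euclidean_space \<Rightarrow> real"
  assumes [measurable]: "f \<in> borel_measurable borel" and c: "0 < c"
  shows "(\<integral>\<^sup>+h. transl_div f (c *\<^sub>R h) * ennreal (1 / norm h powr (real DIM('a) + 2 * s)) \<partial>lborel)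
    = ennreal (c powr (2 * s)) *
      (\<integral>\<^sup>+h. transl_div f h * ennreal (1 / norm h powr (real DIM('a) + 2 * s)) \<partial>lborel)"
    (is "?L = ennreal _ * ?R")
proof -
  define p where "p = real DIM('a) + 2 * s"
  have cp: "c powr (2 * s) * c ^ DIM('a) = c powr p"
    using c by (simp add: p_def powr_add powr_realpow)
  have "ennreal (c powr (2 * s)) * ?R = ennreal (c powr (2 * s)) * (ennreal (c ^ DIM('a)) *
      (\<integral>\<^sup>+h. transl_div f (0 + c *\<^sub>R h) * ennreal (1 / norm (0 + c *\<^sub>R h) powr p) \<partial>lborel))"
    unfolding p_def using c by (subst nn_integral_lborel_affine[where c=c and t=0]) auto
  also have "\<dots> = ennreal (c powr p) *
      (\<integral>\<^sup>+h. transl_div f (c *\<^sub>R h) * ennreal (1 / norm (c *\<^sub>R h) powr p) \<partial>lborel)"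
    using c by (simp add: mult.assoc[symmetric] ennreal_mult[symmetric] cp)
  also have "\<dots> = (\<integral>\<^sup>+h. ennreal (c powr p) *
      (transl_div f (c *\<^sub>R h) * ennreal (1 / norm (c *\<^sub>R h) powr p)) \<partial>lborel)"
    by (rule nn_integral_cmult[symmetric]) measurable
  also have "\<dots> = ?L"
  proof (rule nn_integral_cong)
    fix h :: 'a
    have "ennreal (c powr p) * ennreal (1 / norm (c *\<^sub>R h) powr p) = ennreal (1 / norm h powr p)"
      using c by (simp add: ennreal_mult[symmetric] powr_mult)
    then show "ennreal (c powr p) * (transl_div f (c *\<^sub>R h) * ennreal (1 / norm (c *\<^sub>R h) powr p))
      = transl_div f (c *\<^sub>R h) * ennreal (1 / norm h powr (real DIM('a) + 2 * s))"
      unfolding p_def by (metis mult.left_commute)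
  qed
  finally show ?thesis by simp
qed

text \<open>
  The choice of the proportion \<open>\<alpha> : 1 - \<alpha>\<close> for splitting \<open>h\<close> is what makes the dilation factors come out
  as \<open>\<alpha> / \<surd>\<alpha> = \<surd>\<alpha>\<close> and \<open>(1 - \<alpha>) / \<surd>(1 - \<alpha>) = \<surd>(1 - \<alpha>)\<close>, whose powers of order \<open>2 s\<close> are the
  coefficients in the inequality.
\<close>

lemma frac_fisher_convolution_le_borel:
  fixes f g :: "'a::euclidean_space \<Rightarrow> real"
  assumes f: "pos_density f" and g: "pos_density g" and a: "0 < \<alpha>" "\<alpha> < 1"
  shows "frac_fisher s (convolution (rescale (sqrt \<alpha>) f) (rescale (sqrt (1 - \<alpha>)) g))
           \<le> ennreal (\<alpha> powr s) * frac_fisher s f + ennreal ((1 - \<alpha>) powr s) * frac_fisher s g"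
proof -
  note [measurable] = pos_densityD(1)[OF f] pos_densityD(1)[OF g]
  define F where "F = rescale (sqrt \<alpha>) f"
  define G where "G = rescale (sqrt (1 - \<alpha>)) g"
  define k where "k h = ennreal (1 / norm h powr (real DIM('a) + 2 * s))" for h :: 'a
  have [measurable]: "k \<in> borel_measurable borel" unfolding k_def by measurable
  have F: "pos_density F" and G: "pos_density G"
    unfolding F_def G_def using f g a by (auto intro: pos_density_rescale)
  have "transl_div (convolution F G) h \<le> transl_div f (sqrt \<alpha> *\<^sub>R h) + transl_div g (sqrt (1 - \<alpha>) *\<^sub>R h)" for h
  proof -
    have "transl_div (convolution F G) (\<alpha> *\<^sub>R h + (1 - \<alpha>) *\<^sub>R h)
      \<le> transl_div F (\<alpha> *\<^sub>R h) + transl_div G ((1 - \<alpha>) *\<^sub>R h)"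
      by (rule transl_div_convolution_le[OF F G])
    moreover have "(r *\<^sub>R h) /\<^sub>R sqrt r = sqrt r *\<^sub>R h" if "0 < r" for r
      using that by (simp add: divide_inverse_commute[symmetric] real_div_sqrt)
    ultimately show ?thesis
      using a by (simp add: F_def G_def transl_div_rescale[OF f] transl_div_rescale[OF g]
            scaleR_add_left[symmetric] del: scaleR_scaleR)
  qed
  then have "(\<integral>\<^sup>+h. transl_div (convolution F G) h * k h \<partial>lborel)
    \<le> (\<integral>\<^sup>+h. transl_div f (sqrt \<alpha> *\<^sub>R h) * k h + transl_div g (sqrt (1 - \<alpha>) *\<^sub>R h) * k h \<partial>lborel)"
    by (intro nn_integral_mono) (auto simp: distrib_right[symmetric] intro: mult_right_mono)
  also have "\<dots> = (\<integral>\<^sup>+h. transl_div f (sqrt \<alpha> *\<^sub>R h) * k h \<partial>lborel)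
      + (\<integral>\<^sup>+h. transl_div g (sqrt (1 - \<alpha>) *\<^sub>R h) * k h \<partial>lborel)"
    by (rule nn_integral_add) measurable
  also have "\<dots> = ennreal (\<alpha> powr s) * (\<integral>\<^sup>+h. transl_div f h * k h \<partial>lborel)
      + ennreal ((1 - \<alpha>) powr s) * (\<integral>\<^sup>+h. transl_div g h * k h \<partial>lborel)"
    using a by (simp add: k_def transl_div_dilate_integral powr_half_sqrt[symmetric] powr_powr)
  finally have "(\<integral>\<^sup>+h. transl_div (convolution F G) h * k h \<partial>lborel)
    \<le> ennreal (\<alpha> powr s) * (\<integral>\<^sup>+h. transl_div f h * k h \<partial>lborel)
      + ennreal ((1 - \<alpha>) powr s) * (\<integral>\<^sup>+h. transl_div g h * k h \<partial>lborel)" .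
  then have "fisher_const TYPE('a) s * (\<integral>\<^sup>+h. transl_div (convolution F G) h * k h \<partial>lborel)
    \<le> ennreal (\<alpha> powr s) * (fisher_const TYPE('a) s * (\<integral>\<^sup>+h. transl_div f h * k h \<partial>lborel))
      + ennreal ((1 - \<alpha>) powr s) * (fisher_const TYPE('a) s * (\<integral>\<^sup>+h. transl_div g h * k h \<partial>lborel))"
    by (metis (no_types, lifting) mult_left_mono zero_le distrib_left mult.left_commute)
  then show ?thesis
    unfolding F_def[symmetric] G_def[symmetric]
    using frac_fisher_eq_transl_div[OF convolution_measurable[OF pos_densityD(1)[OF F] pos_densityD(1)[OF G]] convolution_pos, of s]
      frac_fisher_eq_transl_div[OF pos_densityD(1,2)[OF f], of s]
      frac_fisher_eq_transl_div[OF pos_densityD(1,2)[OF g], of s]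
    by (simp add: k_def)
qed

section \<open>Independence of the values on null sets\<close>

text \<open>
  Where a Borel version fails to be positive, which is a null set, it is set to 1.
\<close>

lemma strictly_positive_density_borel_version:
  fixes f :: "'a::euclidean_space \<Rightarrow> real"
  assumes "strictly_positive_density f"
  obtains f' where "pos_density f'" "AE x in lborel. f x = f' x"
proof -
  from assms obtain f0 where [measurable]: "f0 \<in> borel_measurable lborel" and ae: "AE x in lborel. f x = f0 x"
    using completion_ex_borel_measurable_real[of f lborel] by (auto simp: strictly_positive_density_def)
  define f' where "f' x = (if 0 < f0 x then f0 x else 1)" for x
  have [measurable]: "f' \<in> borel_measurable borel" unfolding f'_def by measurable
  have eq: "AE x in lborel. f x = f' x"
    using ae by eventually_elim (use assms in \<open>metis f'_def strictly_positive_density_def\<close>)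
  have "(\<integral>\<^sup>+x. ennreal (f' x) \<partial>lborel) = (\<integral>\<^sup>+x. ennreal (f x) \<partial>lborel)"
    using eq by (intro nn_integral_cong_AE) auto
  then have "pos_density f'"
    using assms by (auto simp: pos_density_def strictly_positive_density_def nn_integral_completion f'_def)
  then show ?thesis using eq by (rule that)
qed

text \<open>
  If \<open>f\<close> and \<open>f'\<close> agree at \<open>x\<close>, then the inner integrands agree for almost every \<open>h\<close>, a translate
  of a null set being null.
\<close>

lemma frac_fisher_cong_AE:
  fixes f f' :: "'a::euclidean_space \<Rightarrow> real"
  assumes eq: "AE x in lborel. f x = f' x"
  shows "frac_fisher s f = frac_fisher s f'"
proof -
  have shift: "AE h in lborel. f (x + h) = f' (x + h)" for x
    using AE_lborel_affine[OF eq, of 1 x] by simp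
  show ?thesis
    unfolding frac_fisher_def nn_integral_completion
  proof (rule arg_cong[where f="(*) _"], rule nn_integral_cong_AE)
    show "AE x in lborel. (\<integral>\<^sup>+h. ennreal (f x * Upsilon (ln (f (x + h)) - ln (f x)) / norm h powr (real DIM('a) + 2 * s)) \<partial>lborel)
      = (\<integral>\<^sup>+h. ennreal (f' x * Upsilon (ln (f' (x + h)) - ln (f' x)) / norm h powr (real DIM('a) + 2 * s)) \<partial>lborel)"
      using eq
    proof eventually_elim
      case (elim x)
      show ?case
        by (rule nn_integral_cong_AE) (use shift[of x] in \<open>eventually_elim, simp add: elim\<close>)
    qed
  qed
qed

text \<open>
  The two convolutions agree at every point, not just almost everywhere, since for each \<open>x\<close> the
  integrands agree for almost every \<open>y\<close>.
\<close>

lemma convolution_rescale_cong_AE: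
  fixes f f' g g' :: "'a::euclidean_space \<Rightarrow> real"
  assumes f: "AE x in lborel. f x = f' x" and g: "AE x in lborel. g x = g' x" and "0 < a" "0 < b"
  shows "convolution (rescale a f) (rescale b g) = convolution (rescale a f') (rescale b g')"
proof -
  have "(\<integral>\<^sup>+y. ennreal (rescale a f (x - y) * rescale b g y) \<partial>lborel)
      = (\<integral>\<^sup>+y. ennreal (rescale a f' (x - y) * rescale b g' y) \<partial>lborel)" for x
  proof (rule nn_integral_cong_AE)
    have "AE y in lborel. f (x /\<^sub>R a + (- inverse a) *\<^sub>R y) = f' (x /\<^sub>R a + (- inverse a) *\<^sub>R y)"
      using \<open>0 < a\<close> by (intro AE_lborel_affine[OF f]) simp
    moreover have "AE y in lborel. g (0 + inverse b *\<^sub>R y) = g' (0 + inverse b *\<^sub>R y)"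
      using \<open>0 < b\<close> by (intro AE_lborel_affine[OF g]) simp
    ultimately show "AE y in lborel. ennreal (rescale a f (x - y) * rescale b g y)
        = ennreal (rescale a f' (x - y) * rescale b g' y)"
      by eventually_elim (simp add: rescale_def scaleR_diff_right)
  qed
  then show ?thesis
    by (simp add: fun_eq_iff convolution_def nn_integral_completion)
qed

theorem theorem5p1:
  fixes s :: real and f g :: "'a::euclidean_space \<Rightarrow> real" and \<alpha> :: real
  assumes "0 < s" and "s < 1"
    and "strictly_positive_density f" and "strictly_positive_density g"
    and "frac_fisher s f < \<infinity>" and "frac_fisher s g < \<infinity>"
    and "0 < \<alpha>" and "\<alpha> < 1"
  shows "frac_fisher s (convolution (rescale (sqrt \<alpha>) f) (rescale (sqrt (1 - \<alpha>)) g))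
           \<le> ennreal (\<alpha> powr s) * frac_fisher s f + ennreal ((1 - \<alpha>) powr s) * frac_fisher s g"
proof -
  obtain f' where f': "pos_density f'" "AE x in lborel. f x = f' x"
    using strictly_positive_density_borel_version[OF assms(3)] .
  obtain g' where g': "pos_density g'" "AE x in lborel. g x = g' x"
    using strictly_positive_density_borel_version[OF assms(4)] .
  have "convolution (rescale (sqrt \<alpha>) f) (rescale (sqrt (1 - \<alpha>)) g)
      = convolution (rescale (sqrt \<alpha>) f') (rescale (sqrt (1 - \<alpha>)) g')"
    using assms(7,8) by (intro convolution_rescale_cong_AE f'(2) g'(2)) auto
  then show ?thesis
    using frac_fisher_convolution_le_borel[OF f'(1) g'(1) assms(7,8), of s]
      frac_fisher_cong_AE[OF f'(2), of s] frac_fisher_cong_AE[OF g'(2), of s] by simp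
qed

end
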